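(* Let $M=(m_{i,j})$ be an $n\times n$ optimal binary matrix. Consider the following rule: if for some $j$ with $1\le j\le n-1$ there are $i_1,i_2$ with $m_{i_1,j}=1$, $m_{i_1,j+1}=0$, $m_{i_2,j}=0$, $m_{i_2,j+1}=1$ and $S_{i_1,j}=S_{i_2,j}$ (where $S_{i,j}=\sum_{l=1}^{j}m_{i,l}$), replace rows $R_{i_1},R_{i_2}$ of the matrix by $R'_{i_1}=(m_{i_1,1},\dots,m_{i_1,j},m_{i_2,j+1},\dots,m_{i_2,n})$ and $R'_{i_2}=(m_{i_2,1},\dots,m_{i_2,j},m_{i_1,j+1},\dots,m_{i_1,n})$. Then by repeated (finitely many) applications of this rule one obtains an optimal matrix $M'$ to which the rule can no longer be applied, i.e. for which there is no $j$ and no such pair $i_1,i_2$ (the scheme $S(M')$ is free of unnecessary bicycle handovers).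
   Context: Biker–hiker model: $n$ travellers $t_1,\dots,t_n$; posts $P_0,\dots,P_n$ at unit spacing; stage $s_j$ is the leg from $P_{j-1}$ to $P_j$. All start at $P_0$ at time $0$, walk at common speed $w$, cycle at common speed $v>w$, mode changes take no time. The $n\times n$ binary matrix $M=(m_{i,j})$ prescribes that $t_i$ cycles $s_j$ iff $m_{i,j}=1$. $M$ is $k$-uniform if every row and every column has exactly $k$ ones. Bicycles start at $P_0$, move only when ridden by one rider, and a traveller due to cycle $s_j$ must take a bicycle present at $P_{j-1}$ when he arrives there. $M$ is optimal if it is $k$-uniform for some $k$ and, with $k$ bicycles, the scheme can be executed with no traveller ever having to wait for a bicycle. *)

theory Defs
  imports Complex_Main "Jordan_Normal_Form.Matrix"
begin

text \<open>
  Matrix indices start at 0, posts keep their numbers \<open>P\<^sub>0, \<dots>, P\<^sub>n\<close>.  Hence row \<open>i\<close> is the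
  \<open>(i+1)\<close>-st traveller, and column \<open>j\<close> is the leg from \<open>P\<^sub>j\<close> to \<open>P\<^sub>j\<^sub>+\<^sub>1\<close>: the entry usually
  written \<open>m\<^sub>i\<^sub>,\<^sub>j\<close> is in column \<open>j - 1\<close>, and it describes how post \<open>P\<^sub>j\<close> is reached.
\<close>

definition binary_matrix :: "nat \<Rightarrow> nat mat \<Rightarrow> bool" where
  "binary_matrix n M \<longleftrightarrow> M \<in> carrier_mat n n \<and> (\<forall>i<n. \<forall>j<n. M $$ (i, j) \<in> {0, 1})"

definition uniform :: "nat \<Rightarrow> nat \<Rightarrow> nat mat \<Rightarrow> bool" where
  "uniform n k M \<longleftrightarrow>
     (\<forall>i<n. card {j. j < n \<and> M $$ (i, j) = 1} = k) \<and>
     (\<forall>j<n. card {i. i < n \<and> M $$ (i, j) = 1} = k)"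

text \<open>The time at which a traveller who never waits arrives at \<open>P\<^sub>j\<close>.\<close>

definition arrival :: "real \<Rightarrow> real \<Rightarrow> nat mat \<Rightarrow> nat \<Rightarrow> nat \<Rightarrow> real" where
  "arrival v w M i j = (\<Sum>l<j. if M $$ (i, l) = 1 then 1 / v else 1 / w)"

text \<open>
  \<open>b i j\<close> is the bicycle that traveller \<open>i\<close> rides from \<open>P\<^sub>j\<close> (relevant only if \<open>i\<close> is due to
  cycle there).  Bicycle \<open>c\<close> is at \<open>P\<^sub>j\<close> at time \<open>t\<close> if it started there or has been ridden
  there by time \<open>t\<close> (a simultaneous arrival suffices), and has not been ridden away before \<open>t\<close>.
\<close>

definition bicycle_present ::
  "real \<Rightarrow> real \<Rightarrow> nat \<Rightarrow> nat mat \<Rightarrow> (nat \<Rightarrow> nat \<Rightarrow> nat) \<Rightarrow> nat \<Rightarrow> nat \<Rightarrow> real \<Rightarrow> bool" where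
  "bicycle_present v w n M b c j t \<longleftrightarrow>
     (j = 0 \<or> (\<exists>i<n. M $$ (i, j - 1) = 1 \<and> b i (j - 1) = c \<and> arrival v w M i j \<le> t)) \<and>
     (\<forall>i<n. M $$ (i, j) = 1 \<and> b i j = c \<longrightarrow> t \<le> arrival v w M i j)"

text \<open>
  Everyone moves only forwards, so a bicycle covers each leg at most once; having one rider,
  it therefore serves at most one traveller per leg, which is the injectivity condition.
\<close>

definition executable_without_waiting :: "real \<Rightarrow> real \<Rightarrow> nat \<Rightarrow> nat \<Rightarrow> nat mat \<Rightarrow> bool" where
  "executable_without_waiting v w n k M \<longleftrightarrow>
     (\<exists>b. (\<forall>i<n. \<forall>j<n. M $$ (i, j) = 1 \<longrightarrow>
              b i j < k \<and> bicycle_present v w n M b (b i j) j (arrival v w M i j)) \<and>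
          (\<forall>j<n. inj_on (\<lambda>i. b i j) {i. i < n \<and> M $$ (i, j) = 1}))"

definition optimal :: "real \<Rightarrow> real \<Rightarrow> nat \<Rightarrow> nat mat \<Rightarrow> bool" where
  "optimal v w n M \<longleftrightarrow>
     binary_matrix n M \<and> (\<exists>k. uniform n k M \<and> executable_without_waiting v w n k M)"

definition S :: "nat mat \<Rightarrow> nat \<Rightarrow> nat \<Rightarrow> nat" where
  "S M i j = (\<Sum>l<j. M $$ (i, l))"

definition unnecessary_handover :: "nat \<Rightarrow> nat mat \<Rightarrow> nat \<Rightarrow> nat \<Rightarrow> nat \<Rightarrow> bool" where
  "unnecessary_handover n M j i\<^sub>1 i\<^sub>2 \<longleftrightarrow>
     1 \<le> j \<and> j < n \<and> i\<^sub>1 < n \<and> i\<^sub>2 < n \<and>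
     M $$ (i\<^sub>1, j - 1) = 1 \<and> M $$ (i\<^sub>1, j) = 0 \<and>
     M $$ (i\<^sub>2, j - 1) = 0 \<and> M $$ (i\<^sub>2, j) = 1 \<and>
     S M i\<^sub>1 j = S M i\<^sub>2 j"

definition swap_tails :: "nat \<Rightarrow> nat mat \<Rightarrow> nat \<Rightarrow> nat \<Rightarrow> nat \<Rightarrow> nat mat" where
  "swap_tails n M j i\<^sub>1 i\<^sub>2 = mat n n (\<lambda>(r, c).
     if r = i\<^sub>1 then (if c < j then M $$ (i\<^sub>1, c) else M $$ (i\<^sub>2, c))
     else if r = i\<^sub>2 then (if c < j then M $$ (i\<^sub>2, c) else M $$ (i\<^sub>1, c))
     else M $$ (r, c))"

definition rule_step :: "nat \<Rightarrow> nat mat \<Rightarrow> nat mat \<Rightarrow> bool" where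
  "rule_step n M M' \<longleftrightarrow>
     (\<exists>j i\<^sub>1 i\<^sub>2. unnecessary_handover n M j i\<^sub>1 i\<^sub>2 \<and> M' = swap_tails n M j i\<^sub>1 i\<^sub>2)"

definition handover_free :: "nat \<Rightarrow> nat mat \<Rightarrow> bool" where
  "handover_free n M \<longleftrightarrow> \<not> (\<exists>j i\<^sub>1 i\<^sub>2. unnecessary_handover n M j i\<^sub>1 i\<^sub>2)"

end

(*
  A rule step at post P_j exchanges the travellers i1 and i2 from post P_j onwards and nothing else:
  column c of the new matrix is column c of the old one with the rows permuted by the identity
  (c < j) or by the transposition of i1 and i2 (c >= j).  As both travellers reach P_j at the same
  time, the exchange is invisible to the timetable, so permuting the bicycle assignment in the same
  way again gives an execution without waiting.  The number of dismounts (a one followed by a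
  zero in a row) drops with every step, since the one of i1 at P_j disappears.
*)
theory Submission
  imports Defs "HOL-Combinatorics.Transposition"
begin

section \<open>Counting ones and arrival times\<close>

lemma binary_matrix_cases:
  assumes "binary_matrix n M" "i < n" "j < n"
  obtains "M $$ (i, j) = 0" | "M $$ (i, j) = 1"
proof -
  have "M $$ (i, j) \<in> {0, 1}"
    using assms by (simp add: binary_matrix_def)
  then show thesis
    using that by auto
qed

lemma card_eq_S:
  assumes "binary_matrix n M" "i < n" "j \<le> n"
  shows "card {l. l < j \<and> M $$ (i, l) = 1} = S M i j"
proof -
  have "S M i j = (\<Sum>l<j. if M $$ (i, l) = 1 then 1 else 0)"
    unfolding S_def
  proof (intro sum.cong refl)
    fix l assume "l \<in> {..<j}"
    then have "l < n" using assms(3) by simp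
    with assms(1,2) show "M $$ (i, l) = (if M $$ (i, l) = 1 then 1 else 0)"
      by (cases rule: binary_matrix_cases) simp_all
  qed
  also have "\<dots> = card ({..<j} \<inter> {l. M $$ (i, l) = 1})"
    by (simp add: sum.If_cases)
  also have "{..<j} \<inter> {l. M $$ (i, l) = 1} = {l. l < j \<and> M $$ (i, l) = 1}"
    by auto
  finally show ?thesis ..
qed

text \<open>Each cycled leg changes the walking time by the same amount, so arrival depends on the
  traveller only through \<open>S\<close>. Hence equality of \<open>S\<close> in the rule makes both
  travellers reach P_j at the same time.\<close>

lemma arrival_eq_S:
  assumes "binary_matrix n M" "i < n" "j \<le> n"
  shows "arrival v w M i j = j / w + S M i j * (1 / v - 1 / w)"
proof -
  have "arrival v w M i j = (\<Sum>l<j. 1 / w + M $$ (i, l) * (1 / v - 1 / w))"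
    unfolding arrival_def
  proof (intro sum.cong refl)
    fix l assume "l \<in> {..<j}"
    then have "l < n" using assms(3) by simp
    with assms(1,2) show "(if M $$ (i, l) = 1 then 1 / v else 1 / w) =
        1 / w + M $$ (i, l) * (1 / v - 1 / w)"
      by (cases rule: binary_matrix_cases) simp_all
  qed
  then show ?thesis
    by (simp add: S_def sum.distrib sum_distrib_right)
qed

text \<open>The second component is the post of the dismount, numbered as in
  \<open>unnecessary_handover\<close>. A set of pairs lets the decrease be shown by an
  injection.\<close>

definition dismounts :: "nat \<Rightarrow> nat mat \<Rightarrow> (nat \<times> nat) set" where
  "dismounts n M =
     {(i, j). i < n \<and> 1 \<le> j \<and> j < n \<and> M $$ (i, j - 1) = 1 \<and> M $$ (i, j) = 0}"

lemma finite_dismounts: "finite (dismounts n M)"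
  by (rule finite_subset[of _ "{..<n} \<times> {..<n}"]) (auto simp: dismounts_def)

section \<open>A single application of the rule\<close>

locale handover =
  fixes n :: nat and M :: "nat mat" and j i\<^sub>1 i\<^sub>2 :: nat
  assumes handover: "unnecessary_handover n M j i\<^sub>1 i\<^sub>2"
begin

text \<open>The argument is the column of a leg or the number of a post. For the arrival at post
  \<open>Suc l\<close> these readings give \<open>perm l\<close> and \<open>perm (Suc l)\<close>,
  which differ only if \<open>Suc l = j\<close>.\<close>

definition perm :: "nat \<Rightarrow> nat \<Rightarrow> nat" where
  "perm c = (if c < j then id else Transposition.transpose i\<^sub>1 i\<^sub>2)"

abbreviation "M' \<equiv> swap_tails n M j i\<^sub>1 i\<^sub>2"

lemma i_less: "i\<^sub>1 < n" "i\<^sub>2 < n" and j_bounds: "1 \<le> j" "j < n" and i_neq: "i\<^sub>1 \<noteq> i\<^sub>2"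
  using handover by (auto simp: unnecessary_handover_def)

lemma perm_perm [simp]: "perm c (perm c i) = i"
  by (simp add: perm_def)

lemma perm_less: "i < n \<Longrightarrow> perm c i < n"
  using i_less by (auto simp: perm_def Transposition.transpose_def)

lemma inj_on_perm: "inj_on (perm c) A"
  by (metis inj_onI perm_perm)

lemma swap_tails_entry:
  assumes "i < n" "c < n"
  shows "M' $$ (i, c) = M $$ (perm c i, c)"
  using assms i_neq by (auto simp: swap_tails_def perm_def Transposition.transpose_def)

text \<open>The only critical case is \<open>Suc l = j\<close>, where the identity turns into the
  transposition; there the assumption equates the sums of the two exchanged rows.\<close>

lemma sum_prefix_perm_Suc:
  assumes "(\<Sum>c<j. g (M $$ (i\<^sub>1, c))) = (\<Sum>c<j. g (M $$ (i\<^sub>2, c)))"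
  shows "(\<Sum>c<Suc l. g (M $$ (perm (Suc l) i, c))) = (\<Sum>c<Suc l. g (M $$ (perm l i, c)))"
proof (cases "Suc l = j")
  case True
  then show ?thesis
    using assms by (auto simp: perm_def Transposition.transpose_def)
next
  case False
  then have "perm (Suc l) = perm l"
    by (auto simp: perm_def)
  then show ?thesis by simp
qed

text \<open>With \<open>g\<close> the identity this yields \<open>S\<close>, with \<open>g\<close>
  the duration of a leg it yields \<open>arrival\<close>. Beyond P_j an exchanged row is its own
  head followed by the partner's tail, and the assumption lets the partner's head stand in for its
  own.\<close>

lemma sum_prefix:
  fixes g :: "nat \<Rightarrow> 'a :: comm_monoid_add"
  assumes "(\<Sum>c<j. g (M $$ (i\<^sub>1, c))) = (\<Sum>c<j. g (M $$ (i\<^sub>2, c)))" "i < n" "l \<le> n"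
  shows "(\<Sum>c<l. g (M' $$ (i, c))) = (\<Sum>c<l. g (M $$ (perm l i, c)))"
  using \<open>l \<le> n\<close>
proof (induction l)
  case (Suc l)
  then have "(\<Sum>c<Suc l. g (M' $$ (i, c))) = (\<Sum>c<Suc l. g (M $$ (perm l i, c)))"
    using swap_tails_entry[OF \<open>i < n\<close>, of l] by simp
  then show ?case
    using sum_prefix_perm_Suc[OF assms(1)] by simp
qed simp

lemma S_swap_tails:
  assumes "i < n" "l \<le> n"
  shows "S M' i l = S M (perm l i) l"
  using sum_prefix[of "\<lambda>x. x" i l] handover assms
  by (simp add: S_def unnecessary_handover_def)

section \<open>Preservation of optimality\<close>

context
  assumes binary: "binary_matrix n M"
begin

lemma arrival_prefix_eq:
  "(\<Sum>c<j. if M $$ (i\<^sub>1, c) = 1 then 1 / v else 1 / w) =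
   (\<Sum>c<j. if M $$ (i\<^sub>2, c) = 1 then 1 / v else 1 / w :: real)"
  using arrival_eq_S[OF binary i_less(1), of j v w] arrival_eq_S[OF binary i_less(2), of j v w]
    handover
  by (simp add: unnecessary_handover_def arrival_def)

lemma arrival_swap_tails:
  assumes "i < n" "l \<le> n"
  shows "arrival v w M' i l = arrival v w M (perm l i) l"
  using sum_prefix[of "\<lambda>x. if x = 1 then 1 / v else 1 / w", OF arrival_prefix_eq assms]
  by (simp add: arrival_def)

text \<open>Post \<open>P\<^sub>j\<close> may be assigned to either permutation, as both travellers reach it together.\<close>

lemma arrival_swap_tails_Suc:
  assumes "i < n" "l < n"
  shows "arrival v w M' i (Suc l) = arrival v w M (perm l i) (Suc l)"
  using arrival_swap_tails[of i "Suc l" v w] assms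
    sum_prefix_perm_Suc[of "\<lambda>x. if x = 1 then 1 / v else 1 / w", OF arrival_prefix_eq, of l i]
  by (simp add: arrival_def)

lemma binary_swap_tails: "binary_matrix n M'"
  unfolding binary_matrix_def
proof (intro conjI allI impI)
  show "M' \<in> carrier_mat n n"
    by (simp add: swap_tails_def)
  show "M' $$ (i, c) \<in> {0, 1}" if "i < n" "c < n" for i c
    using that binary perm_less by (simp add: swap_tails_entry binary_matrix_def)
qed

lemma uniform_swap_tails:
  assumes "uniform n k M"
  shows "uniform n k M'"
  unfolding uniform_def
proof (intro conjI allI impI)
  fix i assume "i < n"
  \<comment> \<open>The number of ones in a row is \<open>S\<close> at the last post, so
    \<open>S_swap_tails\<close> shows that the row counts are merely permuted by
    \<open>perm n\<close>.\<close>
  then show "card {c. c < n \<and> M' $$ (i, c) = 1} = k"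
    using assms card_eq_S[OF binary_swap_tails, of i n] card_eq_S[OF binary, of "perm n i" n]
      S_swap_tails[of i n] perm_less[of i n]
    by (simp add: uniform_def)
next
  fix c assume c: "c < n"
  have "{i. i < n \<and> M' $$ (i, c) = 1} = perm c ` {i. i < n \<and> M $$ (i, c) = 1}"
  proof (intro equalityI subsetI)
    fix i assume "i \<in> {i. i < n \<and> M' $$ (i, c) = 1}"
    then have "perm c i \<in> {i. i < n \<and> M $$ (i, c) = 1}"
      using c by (auto simp: perm_less swap_tails_entry)
    then show "i \<in> perm c ` {i. i < n \<and> M $$ (i, c) = 1}"
      by (rule rev_image_eqI) simp
  next
    fix i assume "i \<in> perm c ` {i. i < n \<and> M $$ (i, c) = 1}"
    then show "i \<in> {i. i < n \<and> M' $$ (i, c) = 1}"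
      using c by (auto simp: perm_less swap_tails_entry)
  qed
  then show "card {i. i < n \<and> M' $$ (i, c) = 1} = k"
    using assms c by (simp add: uniform_def card_image[OF inj_on_perm])
qed

text \<open>Presence at a post involves the riders coming in on column \<open>c - 1\<close> and
  those leaving on column \<open>c\<close>. At \<open>c = j\<close> these are permuted differently;
  \<open>arrival_swap_tails_Suc\<close> handles the incoming riders,
  \<open>arrival_swap_tails\<close> the leaving ones.\<close>

lemma bicycle_present_swap_tails:
  assumes present: "bicycle_present v w n M b q c t" and c: "c < n"
  shows "bicycle_present v w n M' (\<lambda>i c. b (perm c i) c) q c t"
  unfolding bicycle_present_def
proof (intro conjI allI impI)
  show "c = 0 \<or> (\<exists>i<n. M' $$ (i, c - 1) = 1 \<and> b (perm (c - 1) i) (c - 1) = q \<and>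
    arrival v w M' i c \<le> t)"
  proof (cases c)
    case (Suc l)
    then obtain i where i: "i < n" "M $$ (i, l) = 1" "b i l = q" "arrival v w M i c \<le> t"
      using present by (auto simp: bicycle_present_def)
    then have "perm l i < n" "M' $$ (perm l i, l) = 1"
      "arrival v w M' (perm l i) c = arrival v w M i c"
      using Suc c perm_less swap_tails_entry arrival_swap_tails_Suc by auto
    with i Suc show ?thesis
      by (intro disjI2 exI[of _ "perm l i"]) simp
  qed simp
next
  fix i assume "i < n" "M' $$ (i, c) = 1 \<and> b (perm c i) c = q"
  then show "t \<le> arrival v w M' i c"
    using present c perm_less swap_tails_entry arrival_swap_tails
    by (simp add: bicycle_present_def)
qed

lemma executable_swap_tails:
  assumes "executable_without_waiting v w n k M"
  shows "executable_without_waiting v w n k M'"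
proof -
  obtain b where b: "\<And>i c. i < n \<Longrightarrow> c < n \<Longrightarrow> M $$ (i, c) = 1 \<Longrightarrow>
      b i c < k \<and> bicycle_present v w n M b (b i c) c (arrival v w M i c)"
    and inj: "\<And>c. c < n \<Longrightarrow> inj_on (\<lambda>i. b i c) {i. i < n \<and> M $$ (i, c) = 1}"
    using assms by (auto simp: executable_without_waiting_def)
  let ?b = "\<lambda>i c. b (perm c i) c"
  show ?thesis
    unfolding executable_without_waiting_def
  proof (intro exI[of _ ?b] conjI allI impI)
    fix i c assume ic: "i < n" "c < n" and "M' $$ (i, c) = 1"
    then have one: "M $$ (perm c i, c) = 1"
      by (simp add: swap_tails_entry)
    show "?b i c < k"
      using b one ic perm_less by blast
    \<comment> \<open>Traveller \<open>i\<close> takes over both the bicycle and the arrival time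
      that \<open>perm c i\<close> had in the old scheme.\<close>
    show "bicycle_present v w n M' ?b (?b i c) c (arrival v w M' i c)"
      using b[OF perm_less ic(2) one] ic
      by (simp add: arrival_swap_tails bicycle_present_swap_tails)
  next
    fix c assume "c < n"
    then have "perm c ` {i. i < n \<and> M' $$ (i, c) = 1} \<subseteq> {i. i < n \<and> M $$ (i, c) = 1}"
      by (auto simp: perm_less swap_tails_entry)
    then have "inj_on ((\<lambda>i. b i c) \<circ> perm c) {i. i < n \<and> M' $$ (i, c) = 1}"
      using inj[OF \<open>c < n\<close>] by (intro comp_inj_on inj_on_perm) (rule inj_on_subset)
    then show "inj_on (\<lambda>i. ?b i c) {i. i < n \<and> M' $$ (i, c) = 1}"
      by (simp add: comp_def)
  qed
qed

end

lemma optimal_swap_tails: "optimal v w n M \<Longrightarrow> optimal v w n M'"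
  unfolding optimal_def by (metis binary_swap_tails uniform_swap_tails executable_swap_tails)

text \<open>Renaming the row of each new dismount by the permutation of its column gives an
  injection into the old dismounts that misses \<open>(i\<^sub>1, j)\<close>.\<close>

lemma card_dismounts_swap_tails: "card (dismounts n M') < card (dismounts n M)"
proof -
  let ?f = "\<lambda>(i, c). (perm c i, c)"
  have "inj_on ?f (dismounts n M')"
    by (rule inj_onI) (auto dest: inj_onD[OF inj_on_perm])
  then have "card (dismounts n M') = card (?f ` dismounts n M')"
    by (simp add: card_image)
  also have "\<dots> < card (dismounts n M)"
  proof (intro psubset_card_mono finite_dismounts)
    have "?f (i, c) \<in> dismounts n M - {(i\<^sub>1, j)}" if ic: "(i, c) \<in> dismounts n M'" for i c
    proof -
      have bounds: "i < n" "1 \<le> c" "c < n"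
        and old: "M $$ (perm (c - 1) i, c - 1) = 1" "M $$ (perm c i, c) = 0"
        using ic by (auto simp: dismounts_def swap_tails_entry)
      show ?thesis
      proof (cases "c = j")
        case True
        \<comment> \<open>At P_j the new row \<open>i\<^sub>1\<close> reads 1, 1 and the new row
          \<open>i\<^sub>2\<close> reads 0, 0, so neither dismounts there.\<close>
        then have "i \<noteq> i\<^sub>1" "i \<noteq> i\<^sub>2"
          using old handover j_bounds
          by (auto simp: perm_def unnecessary_handover_def)
        then show ?thesis
          using True old bounds by (auto simp: perm_def dismounts_def)
      next
        case False
        \<comment> \<open>Away from P_j both columns undergo the same permutation, so a new dismount
          is an old one of the renamed row.\<close>
        then have "perm (c - 1) = perm c"
          using bounds by (auto simp: perm_def)
        then show ?thesis
          using False old bounds perm_less by (simp add: dismounts_def)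
      qed
    qed
    then have "?f ` dismounts n M' \<subseteq> dismounts n M - {(i\<^sub>1, j)}"
      by (intro image_subsetI) (simp only: split_paired_all)
    moreover have "(i\<^sub>1, j) \<in> dismounts n M"
      using handover by (simp add: dismounts_def unnecessary_handover_def)
    ultimately show "?f ` dismounts n M' \<subset> dismounts n M"
      by blast
  qed
  finally show ?thesis .
qed

end

section \<open>Repeated application and termination\<close>

lemma rule_step_optimal: "rule_step n M M' \<Longrightarrow> optimal v w n M \<Longrightarrow> optimal v w n M'"
  using handover.optimal_swap_tails by (auto simp: rule_step_def handover_def)

lemma rule_steps_optimal:
  assumes "(rule_step n)\<^sup>*\<^sup>* M M'" "optimal v w n M"
  shows "optimal v w n M'"
  using assms by induction (auto intro: rule_step_optimal)

lemma rule_step_card_dismounts: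
  "rule_step n M M' \<Longrightarrow> card (dismounts n M') < card (dismounts n M)"
  using handover.card_dismounts_swap_tails by (auto simp: rule_step_def handover_def)

lemma ex_handover_free: "\<exists>M'. (rule_step n)\<^sup>*\<^sup>* M M' \<and> handover_free n M'"
proof (induction "card (dismounts n M)" arbitrary: M rule: less_induct)
  case less
  show ?case
  proof (cases "handover_free n M")
    case False
    then obtain M' where "rule_step n M M'"
      by (auto simp: handover_free_def rule_step_def)
    then show ?thesis
      using less rule_step_card_dismounts by (meson converse_rtranclp_into_rtranclp)
  qed blast
qed

text \<open>The last two conjuncts cover every order of applying the rule: no choice of steps goes
  on forever, and wherever the process stops the matrix is optimal.\<close>

theorem theorem3p18:
  fixes v w :: real and n :: nat and M :: "nat mat"
  assumes "0 < w" and "w < v"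
    and "optimal v w n M"
  shows "(\<exists>M'. (rule_step n)\<^sup>*\<^sup>* M M' \<and> optimal v w n M' \<and> handover_free n M') \<and>
    (\<nexists>f. f 0 = M \<and> (\<forall>t. rule_step n (f t) (f (Suc t)))) \<and>
    (\<forall>M'. (rule_step n)\<^sup>*\<^sup>* M M' \<and> handover_free n M' \<longrightarrow> optimal v w n M')"
proof (intro conjI)
  show "\<exists>M'. (rule_step n)\<^sup>*\<^sup>* M M' \<and> optimal v w n M' \<and> handover_free n M'"
    using ex_handover_free rule_steps_optimal assms(3) by blast
  show "\<forall>M'. (rule_step n)\<^sup>*\<^sup>* M M' \<and> handover_free n M' \<longrightarrow> optimal v w n M'"
    using rule_steps_optimal assms(3) by blast
  show "\<nexists>f. f 0 = M \<and> (\<forall>t. rule_step n (f t) (f (Suc t)))"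
  proof
    assume "\<exists>f. f 0 = M \<and> (\<forall>t. rule_step n (f t) (f (Suc t)))"
    then obtain f where "\<And>t. rule_step n (f t) (f (Suc t))"
      by blast
    then have "\<forall>t. (f (Suc t), f t) \<in> measure (\<lambda>M. card (dismounts n M))"
      using rule_step_card_dismounts by simp
    then show False
      using wf_measure unfolding wf_iff_no_infinite_down_chain by blast
  qed
qed

end
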